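(* Let $a,m$ be integers with $1<a<m$ and $\gcd(a,m)=1$. For the s-states $\widehat{\mathcal X}_0,\dots,\widehat{\mathcal X}_N$ of Qin's algorithm on input $(a,m)$, with row vectors $\widehat{v_1}^{(k)},\widehat{v_2}^{(k)}$ and quotients $q_k$, let $$\mathcal I_k=\langle \widehat{v_1}^{(k)},\widehat{v_2}^{(k)}\rangle=x_{11}^{(k)}x_{21}^{(k)}-x_{12}^{(k)}x_{22}^{(k)}.$$ Then for every $1\le k\le N$, $$\mathcal I_k=\begin{cases}\mathcal I_{k-1}+q_k\|\widehat{v_1}^{(k)}\|^2 & \text{if } k \text{ is odd},\\ \mathcal I_{k-1}+q_k\|\widehat{v_2}^{(k)}\|^2 & \text{if } k \text{ is even}.\end{cases}$$
   Context: Qin's algorithm on input $(a,m)$ (integers, $1<a<m$, $\gcd(a,m)=1$) produces a finite sequence of states $\mathcal X_k=\begin{pmatrix}x_{11}^{(k)}&x_{12}^{(k)}\\ x_{21}^{(k)}&x_{22}^{(k)}\end{pmatrix}$ as follows. The initial state is $\mathcal X_0=\begin{pmatrix}1&a\\0&m\end{pmatrix}$. For $k\ge 1$, as long as $x_{12}^{(k-1)}\neq 1$, step $k$ produces $\mathcal X_k$ from $\mathcal X_{k-1}$: (i) if $x_{22}^{(k-1)}>x_{12}^{(k-1)}$, set $q_k=\left\lfloor \frac{x_{22}^{(k-1)}-1}{x_{12}^{(k-1)}}\right\rfloor$, $x_{21}^{(k)}=x_{21}^{(k-1)}+q_kx_{11}^{(k-1)}$, $x_{22}^{(k)}=x_{22}^{(k-1)}-q_kx_{12}^{(k-1)}$,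 and leave the first row unchanged; (ii) if $x_{12}^{(k-1)}>x_{22}^{(k-1)}$, set $q_k=\left\lfloor \frac{x_{12}^{(k-1)}-1}{x_{22}^{(k-1)}}\right\rfloor$, $x_{11}^{(k)}=x_{11}^{(k-1)}+q_kx_{21}^{(k-1)}$, $x_{12}^{(k)}=x_{12}^{(k-1)}-q_kx_{22}^{(k-1)}$, and leave the second row unchanged. The algorithm stops at the first index $N$ with $x_{12}^{(N)}=1$; $N$ is the number of steps. The s-state at step $k$ is $\widehat{\mathcal X}_k=\begin{pmatrix}x_{11}^{(k)}&-x_{12}^{(k)}\\ x_{21}^{(k)}&x_{22}^{(k)}\end{pmatrix}$, with row vectors $\widehat{v_1}^{(k)}=(x_{11}^{(k)},-x_{12}^{(k)})$ and $\widehat{v_2}^{(k)}=(x_{21}^{(k)},x_{22}^{(k)})$. Inner product and norm are the Euclidean ones on $\mathbb R^2$. *)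

theory Defs
  imports "HOL-Analysis.Analysis"
begin

definition qin_init :: "int \<Rightarrow> int \<Rightarrow> int^2^2" where
  "qin_init a m = vector [vector [1, a], vector [0, m]]"

text \<open>The branch \<open>x\<^sub>1\<^sub>2 = x\<^sub>2\<^sub>2\<close>, which the algorithm leaves unspecified, gets the quotient 0 and
  leaves the state unchanged. It is not reached on admissible input: the second column stays
  positive and coprime, see \<open>qin_state_invariant\<close>.\<close>

definition qin_quot :: "int^2^2 \<Rightarrow> int" where
  "qin_quot X =
    (if X$2$2 > X$1$2 then (X$2$2 - 1) div X$1$2
     else if X$1$2 > X$2$2 then (X$1$2 - 1) div X$2$2
     else 0)"

definition qin_step :: "int^2^2 \<Rightarrow> int^2^2" where
  "qin_step X = (let q = qin_quot X in
     if X$2$2 > X$1$2 then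
       vector [vector [X$1$1, X$1$2],
               vector [X$2$1 + q * X$1$1, X$2$2 - q * X$1$2]]
     else if X$1$2 > X$2$2 then
       vector [vector [X$1$1 + q * X$2$1, X$1$2 - q * X$2$2],
               vector [X$2$1, X$2$2]]
     else X)"

text \<open>The finite sequence of states is extended to all indices by repeating the final state; only
  indices up to \<open>qin_steps a m\<close> are meaningful.\<close>

primrec qin_state :: "int \<Rightarrow> int \<Rightarrow> nat \<Rightarrow> int^2^2" where
  "qin_state a m 0 = qin_init a m"
| "qin_state a m (Suc k) =
    (if qin_state a m k $ 1 $ 2 \<noteq> 1 then qin_step (qin_state a m k) else qin_state a m k)"

text \<open>The quotient used in step \<open>k\<close>, for \<open>k \<ge> 1\<close>.\<close>

definition qin_q :: "int \<Rightarrow> int \<Rightarrow> nat \<Rightarrow> int" where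
  "qin_q a m k = qin_quot (qin_state a m (k - 1))"

text \<open>The index in the next definition exists on admissible input by \<open>qin_terminates\<close>.\<close>

definition qin_steps :: "int \<Rightarrow> int \<Rightarrow> nat" where
  "qin_steps a m = (LEAST k. qin_state a m k $ 1 $ 2 = 1)"

definition qin_sstate :: "int \<Rightarrow> int \<Rightarrow> nat \<Rightarrow> real^2^2" where
  "qin_sstate a m k = (let X = qin_state a m k in
     vector [vector [of_int (X$1$1), - of_int (X$1$2)],
             vector [of_int (X$2$1), of_int (X$2$2)]])"

definition qin_v1 :: "int \<Rightarrow> int \<Rightarrow> nat \<Rightarrow> real^2" where
  "qin_v1 a m k = row 1 (qin_sstate a m k)"

definition qin_v2 :: "int \<Rightarrow> int \<Rightarrow> nat \<Rightarrow> real^2" where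
  "qin_v2 a m k = row 2 (qin_sstate a m k)"

definition qin_inner :: "int \<Rightarrow> int \<Rightarrow> nat \<Rightarrow> real" where
  "qin_inner a m k = qin_v1 a m k \<bullet> qin_v2 a m k"

lemma qin_step_cases:
  fixes X :: "int^2^2"
  assumes "X$1$2 > 0" "X$2$2 > 0" "coprime (X$1$2) (X$2$2)" "X$1$2 \<noteq> 1"
  shows "X$1$2 \<noteq> X$2$2"
    and "qin_step X $ 1 $ 2 > 0" "qin_step X $ 2 $ 2 > 0"
    and "coprime (qin_step X $ 1 $ 2) (qin_step X $ 2 $ 2)"
    and "qin_step X $ 1 $ 2 + qin_step X $ 2 $ 2 < X$1$2 + X$2$2"
proof -
  show ne: "X$1$2 \<noteq> X$2$2" using assms by auto
  have quot: "(y - 1) div x \<ge> 1 \<and> y - (y - 1) div x * x > 0" if "0 < x" "x < y" for x y :: int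
  proof
    have "x div x \<le> (y - 1) div x" using that by (intro zdiv_mono1) auto
    then show "(y - 1) div x \<ge> 1" using that by simp
    have "(y - 1) div x * x \<le> y - 1"
      using that div_mult_mod_eq[of "y - 1" x] pos_mod_sign[of x "y - 1"] by linarith
    then show "y - (y - 1) div x * x > 0" by simp
  qed
  have cop: "coprime x (y - q * x)" if "coprime x y" for x y q :: int
  proof (rule coprimeI)
    fix d assume d: "d dvd x" "d dvd y - q * x"
    then have "d dvd (y - q * x) + q * x" by (intro dvd_add dvd_mult)
    then show "is_unit d" using coprime_common_divisor[OF that d(1)] by simp
  qed
  consider "X$2$2 > X$1$2" | "X$1$2 > X$2$2" using ne by linarith
  then have "qin_step X $ 1 $ 2 > 0 \<and> qin_step X $ 2 $ 2 > 0 \<and>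
      coprime (qin_step X $ 1 $ 2) (qin_step X $ 2 $ 2) \<and>
      qin_step X $ 1 $ 2 + qin_step X $ 2 $ 2 < X$1$2 + X$2$2"
  proof cases
    case 1
    let ?q = "(X$2$2 - 1) div X$1$2"
    have "?q * X$1$2 > 0" using quot[of "X$1$2" "X$2$2"] 1 assms by simp
    then show ?thesis
      using quot[of "X$1$2" "X$2$2"] 1 assms cop[of "X$1$2" "X$2$2" ?q]
      by (simp add: qin_step_def qin_quot_def Let_def)
  next
    case 2
    let ?q = "(X$1$2 - 1) div X$2$2"
    have "?q * X$2$2 > 0" using quot[of "X$2$2" "X$1$2"] 2 assms by simp
    then show ?thesis
      using quot[of "X$2$2" "X$1$2"] 2 assms cop[of "X$2$2" "X$1$2" ?q]
      by (simp add: qin_step_def qin_quot_def Let_def coprime_commute)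
  qed
  then show "qin_step X $ 1 $ 2 > 0" "qin_step X $ 2 $ 2 > 0"
    "coprime (qin_step X $ 1 $ 2) (qin_step X $ 2 $ 2)"
    "qin_step X $ 1 $ 2 + qin_step X $ 2 $ 2 < X$1$2 + X$2$2" by auto
qed

lemma qin_state_invariant:
  assumes "1 < a" "a < m" "gcd a m = 1"
  shows "qin_state a m k $ 1 $ 2 > 0 \<and> qin_state a m k $ 2 $ 2 > 0 \<and>
    coprime (qin_state a m k $ 1 $ 2) (qin_state a m k $ 2 $ 2)"
proof (induction k)
  case 0
  then show ?case using assms by (simp add: qin_init_def coprime_iff_gcd_eq_1)
next
  case (Suc k)
  then show ?case using qin_step_cases[of "qin_state a m k"] by auto
qed

lemma qin_terminates:
  assumes "1 < a" "a < m" "gcd a m = 1"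
  shows "\<exists>k. qin_state a m k $ 1 $ 2 = 1"
proof (rule ccontr)
  assume "\<not> ?thesis"
  then have ne: "qin_state a m k $ 1 $ 2 \<noteq> 1" for k by blast
  have "qin_state a m k $ 1 $ 2 + qin_state a m k $ 2 $ 2 \<le> a + m - int k" for k
  proof (induction k)
    case 0
    then show ?case by (simp add: qin_init_def)
  next
    case (Suc k)
    then show ?case
      using qin_step_cases(5)[of "qin_state a m k"] qin_state_invariant[OF assms, of k] ne[of k]
      by simp
  qed
  from this[of "nat (a + m)"] show False
    using qin_state_invariant[OF assms, of "nat (a + m)"] assms by simp
qed

end

theory Submission
  imports Defs
begin

text \<open>The minus sign in the s-state turns each step into an elementary row operation with a
  positive sign in both columns: one row stays fixed and \<open>q\<^sub>k\<close> times it is added to the other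
  (\<open>qin_row_operation\<close>). By bilinearity such an operation changes the inner product of the rows by
  exactly \<open>q\<^sub>k\<close> times the squared norm of the fixed row.

  It remains to see that the fixed row is the first at odd steps and the second at even steps. The
  start \<open>a < m\<close> makes step 1 reduce the second row. The quotient \<open>(y - 1) div x\<close> replaces \<open>y\<close> by
  its residue modulo \<open>x\<close> in \<open>{1..x}\<close>, so a step leaves the reduced entry at most as large as the
  other one (\<open>qin_step_reduces\<close>). Equality of two coprime positive entries would make both of them 1
  and the algorithm would have stopped. Hence as long as it runs, every step reverses the strict
  order of the second column, and the two branches alternate (\<open>qin_branch_alternates\<close>).\<close>

lemma qin_state_Suc_before_stop:
  assumes "k < qin_steps a m"
  shows "qin_state a m k $ 1 $ 2 \<noteq> 1"
    and "qin_state a m (Suc k) = qin_step (qin_state a m k)"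
proof -
  show "qin_state a m k $ 1 $ 2 \<noteq> 1"
    using assms not_less_Least unfolding qin_steps_def by blast
  then show "qin_state a m (Suc k) = qin_step (qin_state a m k)" by simp
qed

text \<open>What is left of \<open>y\<close> is \<open>(y - 1) mod x + 1\<close>: the shift by one in the quotient makes the
  residue range over \<open>{1..x}\<close>, so the bound is attained exactly when \<open>x\<close> divides \<open>y\<close>.\<close>

lemma shifted_remainder_le:
  fixes x y :: int
  assumes "0 < x"
  shows "y - (y - 1) div x * x \<le> x"
  using div_mult_mod_eq[of "y - 1" x] pos_mod_bound[OF assms, of "y - 1"] by linarith

lemma qin_step_reduces:
  fixes X :: "int^2^2"
  assumes "X$1$2 > 0" "X$2$2 > 0"
  shows "X$1$2 < X$2$2 \<Longrightarrow> qin_step X $ 2 $ 2 \<le> qin_step X $ 1 $ 2"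
    and "X$2$2 < X$1$2 \<Longrightarrow> qin_step X $ 1 $ 2 \<le> qin_step X $ 2 $ 2"
  using shifted_remainder_le[of "X$1$2" "X$2$2"] shifted_remainder_le[of "X$2$2" "X$1$2"] assms
  by (simp_all add: qin_step_def qin_quot_def Let_def)

text \<open>A step can only produce \<open>\<le>\<close> in the reversed order. Strictness comes from coprimality, and it
  needs that the algorithm has not stopped: in the final state the column may be \<open>(1, 1)\<close>.\<close>

lemma qin_branch_alternates:
  assumes am: "1 < a" "a < m" "gcd a m = 1"
    and "k < qin_steps a m"
  shows "if even k then qin_state a m k $ 1 $ 2 < qin_state a m k $ 2 $ 2
         else qin_state a m k $ 2 $ 2 < qin_state a m k $ 1 $ 2"
  using \<open>k < qin_steps a m\<close>
proof (induction k)
  case 0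
  then show ?case using am by (simp add: qin_init_def)
next
  case (Suc k)
  let ?X = "qin_state a m k" and ?Y = "qin_state a m (Suc k)"
  have k: "k < qin_steps a m" using Suc.prems by simp
  note step = qin_state_Suc_before_stop(2)[OF k]
  have pos: "?X$1$2 > 0" "?X$2$2 > 0" using qin_state_invariant[OF am, of k] by auto
  have ne: "?Y$1$2 \<noteq> ?Y$2$2"
    using qin_step_cases(1)[of ?Y] qin_state_invariant[OF am, of "Suc k"]
      qin_state_Suc_before_stop(1)[OF Suc.prems] by blast
  show ?case
  proof (cases "even k")
    case True
    then have "?Y$2$2 \<le> ?Y$1$2"
      using qin_step_reduces(1)[OF pos] Suc.IH[OF k] unfolding step by simp
    with ne True show ?thesis by (simp del: qin_state.simps)
  next
    case False
    then have "?Y$1$2 \<le> ?Y$2$2"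
      using qin_step_reduces(2)[OF pos] Suc.IH[OF k] unfolding step by simp
    with ne False show ?thesis by (simp del: qin_state.simps)
  qed
qed

lemma qin_v1_eq:
  "qin_v1 a m k = vector [of_int (qin_state a m k $ 1 $ 1), - of_int (qin_state a m k $ 1 $ 2)]"
  by (simp add: qin_v1_def qin_sstate_def Let_def vec_eq_iff row_def forall_2)

lemma qin_v2_eq:
  "qin_v2 a m k = vector [of_int (qin_state a m k $ 2 $ 1), of_int (qin_state a m k $ 2 $ 2)]"
  by (simp add: qin_v2_def qin_sstate_def Let_def vec_eq_iff row_def forall_2)

text \<open>In \<open>qin_state\<close> itself a step adds in the first column and subtracts in the second; negating
  \<open>x\<^sub>1\<^sub>2\<close> makes both columns follow the same rule, which is why a step is linear in the rows of the
  s-state.\<close>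

lemma qin_row_operation:
  assumes "k < qin_steps a m"
  shows "qin_state a m k $ 1 $ 2 < qin_state a m k $ 2 $ 2 \<Longrightarrow>
      qin_v1 a m (Suc k) = qin_v1 a m k \<and>
      qin_v2 a m (Suc k) = qin_v2 a m k + of_int (qin_q a m (Suc k)) *\<^sub>R qin_v1 a m k"
    and "qin_state a m k $ 2 $ 2 < qin_state a m k $ 1 $ 2 \<Longrightarrow>
      qin_v2 a m (Suc k) = qin_v2 a m k \<and>
      qin_v1 a m (Suc k) = qin_v1 a m k + of_int (qin_q a m (Suc k)) *\<^sub>R qin_v2 a m k"
  unfolding qin_v1_eq qin_v2_eq qin_state_Suc_before_stop(2)[OF assms]
  by (simp_all add: qin_step_def qin_q_def Let_def vec_eq_iff forall_2)

lemma qin_inner_eq: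
  "qin_inner a m k =
     of_int (qin_state a m k $ 1 $ 1 * qin_state a m k $ 2 $ 1
             - qin_state a m k $ 1 $ 2 * qin_state a m k $ 2 $ 2)"
  by (simp add: qin_inner_def qin_v1_eq qin_v2_eq inner_vec_def sum_2)

lemma qin_inner_Suc:
  assumes am: "1 < a" "a < m" "gcd a m = 1"
    and k: "k < qin_steps a m"
  shows "qin_inner a m (Suc k) = qin_inner a m k + of_int (qin_q a m (Suc k)) *
    (norm (if even k then qin_v1 a m (Suc k) else qin_v2 a m (Suc k)))\<^sup>2"
proof (cases "even k")
  case True
  then have "qin_state a m k $ 1 $ 2 < qin_state a m k $ 2 $ 2"
    using qin_branch_alternates[OF am k] by simp
  from qin_row_operation(1)[OF k this] True show ?thesis
    by (simp add: qin_inner_def inner_add_right power2_norm_eq_inner)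
next
  case False
  then have "qin_state a m k $ 2 $ 2 < qin_state a m k $ 1 $ 2"
    using qin_branch_alternates[OF am k] by simp
  from qin_row_operation(2)[OF k this] False show ?thesis
    by (simp add: qin_inner_def inner_add_left power2_norm_eq_inner)
qed

theorem proposition4p2:
  fixes a m :: int
  assumes "1 < a" and "a < m" and "gcd a m = 1"
  shows "(\<forall>k \<le> qin_steps a m.
            qin_inner a m k =
              of_int (qin_state a m k $ 1 $ 1 * qin_state a m k $ 2 $ 1
                      - qin_state a m k $ 1 $ 2 * qin_state a m k $ 2 $ 2)) \<and>
         (\<forall>k. 1 \<le> k \<and> k \<le> qin_steps a m \<longrightarrow>
            qin_inner a m k =
              (if odd k
               then qin_inner a m (k - 1) + of_int (qin_q a m k) * (norm (qin_v1 a m k))\<^sup>2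
               else qin_inner a m (k - 1) + of_int (qin_q a m k) * (norm (qin_v2 a m k))\<^sup>2))"
proof (intro conjI allI impI)
  fix k
  show "qin_inner a m k =
      of_int (qin_state a m k $ 1 $ 1 * qin_state a m k $ 2 $ 1
              - qin_state a m k $ 1 $ 2 * qin_state a m k $ 2 $ 2)"
    by (rule qin_inner_eq)
next
  fix k
  assume "1 \<le> k \<and> k \<le> qin_steps a m"
  then obtain j where j: "k = Suc j" "j < qin_steps a m"
    by (cases k) auto
  show "qin_inner a m k =
      (if odd k
       then qin_inner a m (k - 1) + of_int (qin_q a m k) * (norm (qin_v1 a m k))\<^sup>2
       else qin_inner a m (k - 1) + of_int (qin_q a m k) * (norm (qin_v2 a m k))\<^sup>2)"
    using qin_inner_Suc[OF assms j(2)] unfolding j(1) by simp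
qed

end
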